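(* Let $(\pi,w)\in\Delta_n^m\times\Delta_m^\circ$ and let $\sigma=\phi(\pi,w)\in\Delta_{mn}^+$. Then the gap functions of ${\rm VI}(\bar F,\Delta_{mn}^+)$ and ${\rm VI}(F,\Delta_n^m)$ satisfy $$\mathrm{gap}_{\bar F}(\sigma)=\max_{i}\frac{\mathrm{gap}_i(\pi_i,\pi_{\hat i})}{w_i}.$$ Consequently, for $\sigma=\phi(\pi,w)$, $\mathrm{gap}_{\bar F}(\sigma)=0$ if and only if $\mathrm{gap}(\pi)=0$.
   Context: Let $m,n$ be positive integers. $\Delta_n=\{x\in\mathbb{R}^n: x\ge 0,\ \mathbf 1^\top x=1\}$; $\Delta_n^m$ is the product of $m$ copies of $\Delta_n$, with elements $\pi=(\pi_1,\dots,\pi_m)\in\mathbb{R}^{m\times n}$, $\pi_i\in\Delta_n$; $\pi_{\hat i}$ denotes the collection of all $\pi_j$ with $j\ne i$. $\Delta_m^\circ=\{w\in\mathbb{R}^m: w_i>0\ \forall i,\ \sum_i w_i=1\}$. $\Delta_{mn}$ is the unit simplex in $\mathbb{R}^{mn}$, whose elements are written in $m$ blocks $\sigma=(\sigma_1,\dots,\sigma_m)$, $\sigma_i=(\sigma_{i,a})_{a=1}^n\in\mathbb{R}^n$, and $\Delta_{mn}^+=\{\sigma\in\Delta_{mn}:\sum_a\sigma_{i,a}>0\ \text{for all } i\}$. The bijection $\phi:\Delta_n^m\times\Delta_m^\circ\to\Delta_{mn}^+$ is $\phi(\pi,w)=\sigma$ with $\sigma_{i,a}=w_i\pi_{i,a}$;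 its inverse is $\phi^{-1}(\sigma)=(\pi,w)$ with $w_i=\sum_a\sigma_{i,a}$, $\pi_{i,a}=\sigma_{i,a}/\sum_a\sigma_{i,a}$. $F=(F_1,\dots,F_m):\Delta_n^m\to\mathbb{R}^{m\times n}$ is a real-analytic map, $F_i(\pi)\in\mathbb{R}^n$. The map $\bar F:\Delta_{mn}^+\to\mathbb{R}^{mn}$ is given blockwise by $$\bar F_i(\sigma)=\frac1{w_i}\left(F_i(\pi)-(\pi_i^\top F_i(\pi))\mathbf 1\right),\qquad (\pi,w)=\phi^{-1}(\sigma).$$ Gap functions: $\mathrm{gap}(\pi)=\sup_{\pi'\in\Delta_n^m}\langle F(\pi),\pi-\pi'\rangle$; $\mathrm{gap}_i(\pi_i,\pi_{\hat i})=\sup_{\pi_i'\in\Delta_n}\langle F_i(\pi),\pi_i-\pi_i'\rangle$; $\mathrm{gap}_{\bar F}(\sigma)=\sup_{\sigma'\in\Delta_{mn}^+}\langle\bar F(\sigma),\sigma-\sigma'\rangle$. *)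

theory Defs
  imports "HOL-Analysis.Analysis"
begin

definition unit_simplex :: "(real ^ 'k) set" where
  "unit_simplex = {x. (\<forall>i. 0 \<le> x $ i) \<and> (\<Sum>i\<in>UNIV. x $ i) = 1}"

definition open_simplex :: "(real ^ 'k) set" where
  "open_simplex = {w. (\<forall>i. 0 < w $ i) \<and> (\<Sum>i\<in>UNIV. w $ i) = 1}"

definition simplex_product :: "(real ^ 'n ^ 'm) set" where
  "simplex_product = {\<pi>. \<forall>i. \<pi> $ i \<in> unit_simplex}"

text \<open>
  The space of dimension \<open>mn\<close> is indexed by pairs: the entry \<open>a\<close> of block \<open>i\<close>
  of \<open>\<sigma>\<close> is \<open>\<sigma> $ (i, a)\<close>.
\<close>

definition simplex_plus :: "(real ^ ('m::finite \<times> 'n::finite)) set" where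
  "simplex_plus = {\<sigma> \<in> unit_simplex. \<forall>i. 0 < (\<Sum>a\<in>UNIV. \<sigma> $ (i, a))}"

definition phi :: "(real ^ 'n ^ 'm) \<times> (real ^ 'm) \<Rightarrow> real ^ ('m \<times> 'n)" where
  "phi = (\<lambda>(\<pi>, w). vec_lambda (\<lambda>(i, a). w $ i * \<pi> $ i $ a))"

definition phi_inv :: "real ^ ('m \<times> 'n) \<Rightarrow> (real ^ 'n ^ 'm) \<times> (real ^ 'm)" where
  "phi_inv \<sigma> =
    ((\<chi> i a. \<sigma> $ (i, a) / (\<Sum>b\<in>UNIV. \<sigma> $ (i, b))), (\<chi> i. \<Sum>b\<in>UNIV. \<sigma> $ (i, b)))"

definition Fbar :: "(real ^ 'n ^ 'm \<Rightarrow> real ^ 'n ^ 'm) \<Rightarrow> real ^ ('m \<times> 'n) \<Rightarrow> real ^ ('m \<times> 'n)" where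
  "Fbar F \<sigma> = (let (\<pi>, w) = phi_inv \<sigma> in
    vec_lambda (\<lambda>(i, a). (1 / w $ i) * (F \<pi> $ i $ a - \<pi> $ i \<bullet> F \<pi> $ i)))"

text \<open>
  Real analyticity at a point: the map is the sum of a multivariate power series on a
  neighbourhood. The multi-indices are the functions from the standard basis to \<open>nat\<close>
  (extensional, so that each one occurs exactly once), and \<open>has_sum\<close> is
  unconditional summation, which is absolute convergence for a finite-dimensional target.
\<close>

definition real_analytic_at :: "('a::euclidean_space \<Rightarrow> 'b::euclidean_space) \<Rightarrow> 'a \<Rightarrow> bool" where
  "real_analytic_at f x \<longleftrightarrow> (\<exists>r>0. \<exists>c :: ('a \<Rightarrow> nat) \<Rightarrow> 'b. \<forall>y\<in>ball x r.
    ((\<lambda>\<alpha>. (\<Prod>b\<in>Basis. ((y - x) \<bullet> b) ^ \<alpha> b) *\<^sub>R c \<alpha>) has_sum f y)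
      (Basis \<rightarrow>\<^sub>E UNIV))"

text \<open>On a set that need not be open, analyticity means that an analytic extension to an
  open neighbourhood exists.\<close>

definition real_analytic_on :: "('a::euclidean_space \<Rightarrow> 'b::euclidean_space) \<Rightarrow> 'a set \<Rightarrow> bool" where
  "real_analytic_on f S \<longleftrightarrow> (\<exists>U g. open U \<and> S \<subseteq> U \<and>
    (\<forall>x\<in>U. real_analytic_at g x) \<and> (\<forall>x\<in>S. f x = g x))"

text \<open>
  The suprema below are over nonempty sets and, since all simplices involved are bounded,
  they are bounded above, so the real-valued \<open>Sup\<close> is the true supremum.
\<close>

definition vi_gap :: "('a::real_inner \<Rightarrow> 'a) \<Rightarrow> 'a set \<Rightarrow> 'a \<Rightarrow> real" where
  "vi_gap F C x = (SUP x'\<in>C. F x \<bullet> (x - x'))"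

definition gap_block :: "(real ^ 'n ^ 'm \<Rightarrow> real ^ 'n ^ 'm) \<Rightarrow> 'm \<Rightarrow> real ^ 'n ^ 'm \<Rightarrow> real" where
  "gap_block F i \<pi> = (SUP p\<in>unit_simplex. F \<pi> $ i \<bullet> (\<pi> $ i - p))"

lemma phi_in_simplex_plus:
  assumes "\<pi> \<in> simplex_product" "w \<in> open_simplex"
  shows "phi (\<pi>, w) \<in> simplex_plus"
proof -
  have s: "(\<Sum>a\<in>UNIV. phi (\<pi>, w) $ (i, a)) = w $ i" for i
    using assms by (simp add: phi_def simplex_product_def unit_simplex_def flip: sum_distrib_left)
  have "(\<Sum>q\<in>UNIV. phi (\<pi>, w) $ q) = (\<Sum>i\<in>UNIV. \<Sum>a\<in>UNIV. phi (\<pi>, w) $ (i, a))"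
    by (simp add: sum.cartesian_product flip: UNIV_Times_UNIV)
  moreover have "0 \<le> phi (\<pi>, w) $ q" for q
    using assms
    by (cases q) (auto simp: phi_def simplex_product_def unit_simplex_def open_simplex_def less_imp_le)
  ultimately show ?thesis
    using assms by (simp add: s simplex_plus_def unit_simplex_def open_simplex_def)
qed

lemma phi_inv_phi:
  assumes "\<pi> \<in> simplex_product" "w \<in> open_simplex"
  shows "phi_inv (phi (\<pi>, w)) = (\<pi>, w)"
proof -
  have s: "(\<Sum>a\<in>UNIV. phi (\<pi>, w) $ (i, a)) = w $ i" for i
    using assms by (simp add: phi_def simplex_product_def unit_simplex_def flip: sum_distrib_left)
  have "w $ i \<noteq> 0" for i
    using assms by (simp add: open_simplex_def less_imp_neq[symmetric])
  then show ?thesis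
    by (simp add: phi_inv_def s vec_eq_iff) (simp add: phi_def)
qed

lemma phi_inv_in:
  assumes "\<sigma> \<in> simplex_plus"
  shows "phi_inv \<sigma> \<in> simplex_product \<times> open_simplex"
proof -
  have pos: "0 < (\<Sum>a\<in>UNIV. \<sigma> $ (i, a))" for i
    using assms by (simp add: simplex_plus_def)
  have "(\<Sum>i\<in>UNIV. \<Sum>a\<in>UNIV. \<sigma> $ (i, a)) = (\<Sum>q\<in>UNIV. \<sigma> $ q)"
    by (simp add: sum.cartesian_product flip: UNIV_Times_UNIV)
  then show ?thesis
    using assms pos less_imp_neq[OF pos, symmetric]
    by (auto simp: phi_inv_def simplex_product_def open_simplex_def simplex_plus_def
        unit_simplex_def less_imp_le simp flip: sum_divide_distrib intro!: divide_nonneg_pos)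
qed

lemma phi_phi_inv:
  assumes "\<sigma> \<in> simplex_plus"
  shows "phi (phi_inv \<sigma>) = \<sigma>"
proof -
  have "(\<Sum>a\<in>UNIV. \<sigma> $ (i, a)) \<noteq> 0" for i
    using assms by (simp add: simplex_plus_def less_imp_neq[symmetric])
  then show ?thesis
    by (simp add: phi_inv_def phi_def vec_eq_iff)
qed

lemma bij_betw_phi: "bij_betw phi (simplex_product \<times> open_simplex) simplex_plus"
proof (rule bij_betw_byWitness[where f' = phi_inv])
  show "phi_inv ` simplex_plus \<subseteq> simplex_product \<times> open_simplex"
    using phi_inv_in by (rule image_subsetI)
qed (auto simp: phi_inv_phi phi_phi_inv phi_in_simplex_plus)

end

theory Submission
  imports Defs
begin

text \<open>
  For \<open>\<sigma> = \<phi>(\<pi>, w)\<close> and \<open>\<sigma>' = \<phi>(\<pi>', w')\<close> the pairing \<open>\<langle>Fbar \<sigma>, \<sigma> - \<sigma>'\<rangle>\<close> is the average, with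
  weights \<open>w'\<close>, of the block regrets \<open>\<langle>F\<^sub>i \<pi>, \<pi>\<^sub>i - \<pi>'\<^sub>i\<rangle> / w\<^sub>i\<close>. An average is at most the
  maximum, and letting \<open>w'\<close> tend to a vertex of the simplex shows that the supremum is the
  maximum, although it need not be attained because \<open>w'\<close> has to stay positive. Block gaps are
  nonnegative, so the maximum vanishes iff all of them do, which is also when the gap over
  the product vanishes.
\<close>

text \<open>By Cauchy-Schwarz. Boundedness is what lets \<open>cSUP_upper\<close> treat the
  real-valued supremum as an upper bound.\<close>

lemma bdd_above_gap:
  fixes v :: "'a::euclidean_space"
  assumes "bounded C"
  shows "bdd_above ((\<lambda>y. v \<bullet> (x - y)) ` C)"
proof -
  obtain B where B: "\<And>y. y \<in> C \<Longrightarrow> norm y \<le> B"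
    using assms bounded_iff by blast
  have "v \<bullet> (x - y) \<le> norm v * (norm x + B)" if "y \<in> C" for y
    using norm_cauchy_schwarz[of v "x - y"] norm_triangle_ineq4[of x y] B[OF that]
      mult_left_mono[of "norm (x - y)" "norm x + B" "norm v"] by simp
  then show ?thesis
    by (rule bdd_aboveI2)
qed

lemma bounded_unit_simplex: "bounded (unit_simplex :: (real ^ 'k) set)"
proof (rule bounded_subset[OF bounded_cbox[of 0 1]])
  show "unit_simplex \<subseteq> cbox 0 (1 :: real ^ 'k)"
  proof
    fix x :: "real ^ 'k" assume x: "x \<in> unit_simplex"
    have "x $ i \<le> 1" for i
      using x member_le_sum[of i UNIV "\<lambda>i. x $ i"] by (simp add: unit_simplex_def)
    with x show "x \<in> cbox 0 1"
      by (simp add: mem_box_cart unit_simplex_def)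
  qed
qed

lemma gap_block_ge:
  assumes "p \<in> unit_simplex"
  shows "F \<pi> $ i \<bullet> (\<pi> $ i - p) \<le> gap_block F i \<pi>"
  unfolding gap_block_def
  using assms by (intro cSUP_upper bdd_above_gap bounded_unit_simplex)

text \<open>The hypothesis on \<pi> makes the simplex nonempty, as \<open>cSUP_least\<close>
  demands.\<close>

lemma gap_block_le:
  assumes "\<pi> \<in> simplex_product"
    and "\<And>p. p \<in> unit_simplex \<Longrightarrow> F \<pi> $ i \<bullet> (\<pi> $ i - p) \<le> c"
  shows "gap_block F i \<pi> \<le> c"
  unfolding gap_block_def
proof (rule cSUP_least)
  show "unit_simplex \<noteq> ({} :: (real ^ 'a) set)"
    using assms(1) by (auto simp: simplex_product_def)
qed (fact assms(2))

text \<open>Staying at \<open>\<pi> $ i\<close> has regret 0.\<close>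

lemma gap_block_nonneg:
  assumes "\<pi> \<in> simplex_product"
  shows "0 \<le> gap_block F i \<pi>"
  using gap_block_ge[of "\<pi> $ i" F \<pi> i] assms by (simp add: simplex_product_def)

lemma update_block_in_simplex_product:
  assumes "\<pi> \<in> simplex_product" "p \<in> unit_simplex"
  shows "(\<chi> j. if j = k then p else \<pi> $ j) \<in> simplex_product"
  using assms by (simp add: simplex_product_def)

text \<open>The inner product splits into block regrets, each at most its block gap. The bound does
  not depend on \<pi>', so it also shows that the set behind the gap over the product is bounded
  above.\<close>

lemma inner_simplex_product_le:
  assumes "\<pi>' \<in> simplex_product"
  shows "F \<pi> \<bullet> (\<pi> - \<pi>') \<le> (\<Sum>i\<in>UNIV. gap_block F i \<pi>)"
  unfolding inner_vec_def[of "F \<pi>"]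
  using assms by (auto simp: simplex_product_def intro!: sum_mono gap_block_ge)

text \<open>A deviation in block \<open>k\<close> alone leaves a zero difference in every other
  block; this turns block regrets into regrets over the product.\<close>

lemma inner_update_block:
  fixes v \<pi> :: "real ^ 'n ^ 'm"
  shows "v \<bullet> (\<pi> - (\<chi> j. if j = k then p else \<pi> $ j)) = v $ k \<bullet> (\<pi> $ k - p)"
proof -
  have "v \<bullet> (\<pi> - (\<chi> j. if j = k then p else \<pi> $ j))
      = (\<Sum>i\<in>UNIV. if i = k then v $ k \<bullet> (\<pi> $ k - p) else 0)"
    unfolding inner_vec_def[of v] by (rule sum.cong) auto
  then show ?thesis
    by simp
qed

lemma Max_range_eq_0_iff:
  fixes f :: "'k::finite \<Rightarrow> real"
  assumes "\<And>i. 0 \<le> f i"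
  shows "(MAX i. f i) = 0 \<longleftrightarrow> (\<forall>i. f i = 0)"
proof
  assume "(MAX i. f i) = 0"
  then have "f i \<le> 0" for i
    using Max_ge[of "range f" "f i"] by simp
  then show "\<forall>i. f i = 0"
    using assms by (simp add: order_antisym)
qed simp

text \<open>The gap over the product is squeezed between each block gap and the sum of all block
  gaps, and all of these are nonnegative.\<close>

lemma vi_gap_simplex_product_eq_0_iff:
  assumes \<pi>: "\<pi> \<in> simplex_product"
  shows "vi_gap F simplex_product \<pi> = 0 \<longleftrightarrow> (\<forall>i. gap_block F i \<pi> = 0)"
proof -
  let ?G = "vi_gap F simplex_product \<pi>"
  have upper: "F \<pi> \<bullet> (\<pi> - \<pi>') \<le> ?G" if "\<pi>' \<in> simplex_product" for \<pi>'
    unfolding vi_gap_def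
    using that inner_simplex_product_le by (intro cSUP_upper bdd_aboveI2)
  have "gap_block F i \<pi> \<le> ?G" for i
  proof (rule gap_block_le[OF \<pi>])
    fix p :: "real ^ 'a" assume "p \<in> unit_simplex"
    then show "F \<pi> $ i \<bullet> (\<pi> $ i - p) \<le> ?G"
      using upper[OF update_block_in_simplex_product[OF \<pi>, of p i]]
      by (simp only: inner_update_block)
  qed
  moreover have "?G \<le> (\<Sum>i\<in>UNIV. gap_block F i \<pi>)"
    unfolding vi_gap_def using \<pi> inner_simplex_product_le by (intro cSUP_least) auto
  moreover have "0 \<le> ?G"
    using upper[OF \<pi>] by simp
  ultimately show ?thesis
    using gap_block_nonneg[OF \<pi>] by (metis order_antisym sum.neutral)
qed

lemma inner_phi:
  fixes v :: "real ^ ('m::finite \<times> 'n::finite)"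
  shows "v \<bullet> phi (\<pi>, w) = (\<Sum>i\<in>UNIV. w $ i * (\<Sum>a\<in>UNIV. v $ (i, a) * \<pi> $ i $ a))"
  unfolding inner_vec_def
  by (simp add: phi_def sum.cartesian_product sum_distrib_left mult_ac case_prod_unfold
      flip: UNIV_Times_UNIV)

text \<open>\<open>phi\<close> contributes the weights \<open>w'\<close>, and \<open>Fbar\<close>
  the division by \<open>w $ i\<close>. Since \<open>\<pi>' $ i\<close> sums to 1, the centring term
  of \<open>Fbar\<close> contributes exactly \<open>\<pi> $ i \<bullet> F \<pi> $ i\<close>, which
  completes the regret.\<close>

lemma inner_Fbar_phi:
  assumes \<pi>: "\<pi> \<in> simplex_product" "w \<in> open_simplex" and \<pi>': "\<pi>' \<in> simplex_product"
  shows "Fbar F (phi (\<pi>, w)) \<bullet> phi (\<pi>', w')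
    = - (\<Sum>i\<in>UNIV. w' $ i * (F \<pi> $ i \<bullet> (\<pi> $ i - \<pi>' $ i) / w $ i))"
proof -
  have "(\<Sum>a\<in>UNIV. Fbar F (phi (\<pi>, w)) $ (i, a) * \<pi>' $ i $ a)
      = - (F \<pi> $ i \<bullet> (\<pi> $ i - \<pi>' $ i) / w $ i)" for i
  proof -
    have "(\<Sum>a\<in>UNIV. \<pi>' $ i $ a) = 1"
      using \<pi>' by (simp add: simplex_product_def unit_simplex_def)
    moreover have "(\<Sum>a\<in>UNIV. F \<pi> $ i $ a * \<pi>' $ i $ a) = F \<pi> $ i \<bullet> \<pi>' $ i"
      by (simp add: inner_vec_def)
    ultimately have "(\<Sum>a\<in>UNIV. (F \<pi> $ i $ a - \<pi> $ i \<bullet> F \<pi> $ i) * \<pi>' $ i $ a)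
        = - (F \<pi> $ i \<bullet> (\<pi> $ i - \<pi>' $ i))"
      by (simp add: left_diff_distrib sum_subtractf inner_diff_right
          inner_commute[of "\<pi> $ i"] flip: sum_distrib_left)
    then show ?thesis
      by (simp add: Fbar_def phi_inv_phi[OF \<pi>] flip: sum_divide_distrib)
  qed
  then show ?thesis
    by (simp add: inner_phi sum_negf)
qed

text \<open>Taking \<pi>' = \<pi> and w' = w in \<open>inner_Fbar_phi\<close> shows that the
  centring makes \<open>Fbar\<close> orthogonal to its own argument, so only the pairing with
  \<open>phi (\<pi>', w')\<close> survives.\<close>

lemma inner_Fbar_phi_diff:
  assumes "\<pi> \<in> simplex_product" "w \<in> open_simplex" "\<pi>' \<in> simplex_product"
  shows "Fbar F (phi (\<pi>, w)) \<bullet> (phi (\<pi>, w) - phi (\<pi>', w'))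
    = (\<Sum>i\<in>UNIV. w' $ i * (F \<pi> $ i \<bullet> (\<pi> $ i - \<pi>' $ i) / w $ i))"
  using assms by (simp add: inner_diff_right[of "Fbar _ _"] inner_Fbar_phi)

lemma vi_gap_Fbar:
  fixes F :: "real ^ 'n ^ 'm \<Rightarrow> real ^ 'n ^ 'm"
  assumes \<pi>: "\<pi> \<in> simplex_product" and w: "w \<in> open_simplex"
  shows "vi_gap (Fbar F) simplex_plus (phi (\<pi>, w)) = (MAX i. gap_block F i \<pi> / w $ i)"
proof -
  let ?\<sigma> = "phi (\<pi>, w)"
  let ?G = "vi_gap (Fbar F) simplex_plus ?\<sigma>"
  let ?M = "MAX i. gap_block F i \<pi> / w $ i"
  have wpos: "0 < w $ i" for i
    using w by (simp add: open_simplex_def)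
  have le_M: "Fbar F ?\<sigma> \<bullet> (?\<sigma> - \<sigma>') \<le> ?M" if "\<sigma>' \<in> simplex_plus" for \<sigma>'
  proof -
    obtain \<pi>' w' where \<sigma>': "\<sigma>' = phi (\<pi>', w')" "\<pi>' \<in> simplex_product" "w' \<in> open_simplex"
      using \<open>\<sigma>' \<in> simplex_plus\<close> bij_betw_imp_surj_on[OF bij_betw_phi] by blast
    have "F \<pi> $ i \<bullet> (\<pi> $ i - \<pi>' $ i) / w $ i \<le> ?M" for i
    proof -
      have "F \<pi> $ i \<bullet> (\<pi> $ i - \<pi>' $ i) \<le> gap_block F i \<pi>"
        using \<sigma>'(2) by (intro gap_block_ge) (simp add: simplex_product_def)
      then have "F \<pi> $ i \<bullet> (\<pi> $ i - \<pi>' $ i) / w $ i \<le> gap_block F i \<pi> / w $ i"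
        using wpos[of i] by (simp add: divide_right_mono)
      also have "\<dots> \<le> ?M"
        by (rule Max_ge) auto
      finally show ?thesis .
    qed
    then have "Fbar F ?\<sigma> \<bullet> (?\<sigma> - \<sigma>') \<le> (\<Sum>i\<in>UNIV. w' $ i * ?M)"
      using \<sigma>' unfolding \<sigma>'(1) inner_Fbar_phi_diff[OF \<pi> w \<sigma>'(2)]
      by (intro sum_mono mult_left_mono) (auto simp: open_simplex_def less_imp_le)
    also have "\<dots> = ?M"
      using \<sigma>'(3) by (simp add: open_simplex_def flip: sum_distrib_right)
    finally show ?thesis .
  qed
  \<comment> \<open>The bound \<open>le_M\<close> is uniform in \<sigma>', so it doubles as the
    boundedness that \<open>cSUP_upper\<close> needs.\<close>
  have le_G: "Fbar F ?\<sigma> \<bullet> (?\<sigma> - \<sigma>') \<le> ?G" if "\<sigma>' \<in> simplex_plus" for \<sigma>'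
    unfolding vi_gap_def using that le_M by (intro cSUP_upper bdd_aboveI2)
  have "?G \<le> ?M"
    unfolding vi_gap_def using phi_in_simplex_plus[OF \<pi> w] le_M by (intro cSUP_least) auto
  moreover have "?M \<le> ?G"
  proof -
    have G0: "0 \<le> ?G"
      using le_G[OF phi_in_simplex_plus[OF \<pi> w]] by simp
    have "gap_block F k \<pi> / w $ k \<le> ?G" for k
    proof -
      have "F \<pi> $ k \<bullet> (\<pi> $ k - p) / w $ k \<le> ?G" (is "?A \<le> ?G")
        if p: "p \<in> unit_simplex" for p
      \<comment> \<open>A lower bound on the weight of block \<open>k\<close> helps only when
        \<open>?A\<close> is positive; otherwise \<open>G0\<close> suffices.\<close>
      proof (cases "?A \<le> 0")
        case False
        show ?thesis
        \<comment> \<open>Bounding \<open>z * ?A\<close> for all \<open>z\<close> strictly between 0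
          and 1 stands in for the limit at the vertex.\<close>
        proof (rule field_le_mult_one_interval)
          fix z :: real assume z: "0 < z" "z < 1"
          \<comment> \<open>\<open>w'\<close> lies between \<open>w\<close> and vertex
            \<open>k\<close>: the share \<open>1 - z\<close> of \<open>w\<close> keeps all weights
            positive, and the weight of \<open>k\<close> is at least \<open>z\<close>.\<close>
          define w' where "w' = z *\<^sub>R axis k 1 + (1 - z) *\<^sub>R w"
          \<comment> \<open>Outside block \<open>k\<close>, \<pi>' agrees with \<pi>, so those
            regrets vanish whatever their weights.\<close>
          define \<pi>' where "\<pi>' = (\<chi> j. if j = k then p else \<pi> $ j)"
          have w': "w' \<in> open_simplex"
            using w z by (auto simp: w'_def open_simplex_def axis_def sum.distrib
                intro!: add_nonneg_pos simp flip: sum_distrib_left)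
          have \<pi>': "\<pi>' \<in> simplex_product"
            unfolding \<pi>'_def by (rule update_block_in_simplex_product[OF \<pi> p])
          have "Fbar F ?\<sigma> \<bullet> (?\<sigma> - phi (\<pi>', w'))
              = (\<Sum>i\<in>UNIV. if i = k then w' $ k * ?A else 0)"
            unfolding inner_Fbar_phi_diff[OF \<pi> w \<pi>']
            by (rule sum.cong) (auto simp: \<pi>'_def)
          then have "w' $ k * ?A \<le> ?G"
            using le_G[OF phi_in_simplex_plus[OF \<pi>' w']] by simp
          moreover have "z \<le> w' $ k"
            using z wpos[of k] by (simp add: w'_def axis_def)
          ultimately show "z * ?A \<le> ?G"
            using False mult_right_mono[of z "w' $ k" ?A] by linarith
        qed
      qed (use G0 in linarith)
      \<comment> \<open>Multiplying by the positive \<open>w $ k\<close> gives a bound on the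
        undivided regrets that is free of \<open>p\<close>, so it passes to their supremum.\<close>
      then have "gap_block F k \<pi> \<le> ?G * w $ k"
        using wpos[of k] by (intro gap_block_le[OF \<pi>]) (simp add: pos_divide_le_eq)
      then show ?thesis
        using wpos[of k] by (simp add: pos_divide_le_eq)
    qed
    then show ?thesis
      by (subst Max_le_iff) auto
  qed
  ultimately show ?thesis
    by (rule order_antisym)
qed

theorem theorem5:
  fixes F :: "real ^ 'n ^ 'm \<Rightarrow> real ^ 'n ^ 'm"
    and \<pi> :: "real ^ 'n ^ 'm" and w :: "real ^ 'm" and \<sigma> :: "real ^ ('m \<times> 'n)"
  assumes "real_analytic_on F simplex_product"
    and "\<pi> \<in> simplex_product" and "w \<in> open_simplex" and "\<sigma> = phi (\<pi>, w)"
  shows "vi_gap (Fbar F) simplex_plus \<sigma> = (MAX i. gap_block F i \<pi> / w $ i)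
    \<and> (vi_gap (Fbar F) simplex_plus \<sigma> = 0 \<longleftrightarrow> vi_gap F simplex_product \<pi> = 0)"
proof -
  have wpos: "0 < w $ i" for i
    using assms(3) by (simp add: open_simplex_def)
  have nonneg: "0 \<le> gap_block F i \<pi> / w $ i" for i
    using gap_block_nonneg[OF assms(2)] wpos[of i] by simp
  have "(MAX i. gap_block F i \<pi> / w $ i) = 0 \<longleftrightarrow> (\<forall>i. gap_block F i \<pi> / w $ i = 0)"
    using nonneg by (rule Max_range_eq_0_iff)
  also have "\<dots> \<longleftrightarrow> (\<forall>i. gap_block F i \<pi> = 0)"
    using wpos by (simp add: less_imp_neq[symmetric])
  finally show ?thesis
    using vi_gap_Fbar[OF assms(2,3)] vi_gap_simplex_product_eq_0_iff[OF assms(2)] assms(4)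
    by simp
qed

end
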